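(* Let $l$ be an odd positive integer, let $g\in\mathbb{F}_2[x]$ be a divisor of $x^l-1$, let $R=\mathbb{F}_2[x]/(x^l-1)$, and let $u,v\in R$ be arbitrary. Put $a=gu$ and $b=gv$ in $R$, and let $k=k(a,b)$ be the dimension of the bicycle code defined by $(a,b)$. Then $$2\deg g\;\le\;k\;\le\;2\deg g+2\deg\gcd\Bigl(u,\,v,\,\tfrac{x^{l}-1}{g}\Bigr).$$ In particular, if no irreducible factor of $(x^l-1)/g$ over $\mathbb{F}_2$ divides both $u$ and $v$, then $k=2\deg g$. Moreover, every bicycle code of dimension $k$, given by any $a,b\in R$, admits such a presentation $a=gu$, $b=gv$ with $u,v\in R$ and $g=\gcd(a,b,x^l-1)$, where $\deg g=k/2$.
   Context: For $a(x)=\sum_{i=0}^{l-1}\alpha_i x^i\in R$, $\mathrm{circ}(a(x))$ is the $l\times l$ circulant matrix over $\mathbb{F}_2$ representing multiplication by $a(x)$ on $R$ in the basis $1,x,\dots,x^{l-1}$, i.e. $\mathrm{circ}(a)=\sum_i\alpha_i P^i$, where $P$ is the cyclic-shift permutation matrix of multiplication by $x$. The bicycle code defined by $(a,b)\in R^2$ is the CSS quantum code of length $n=2l$ with check matrices $H_X=[\,A\mid B\,]$ and $H_Z=[\,B^{T}\mid A^{T}\,]$, where $A=\mathrm{circ}(a)$, $B=\mathrm{circ}(b)$; its dimension is $k(a,b)=2l-\operatorname{rank}H_X-\operatorname{rank}H_Z$ (ranks over $\mathbb{F}_2$). Gcds involving elements of $R$ and a divisor of $x^l-1$ are taken in $\mathbb{F}_2[x]$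 using polynomial representatives (the result does not depend on the representatives), and divisibility of an element of $R$ by a divisor of $x^l-1$ is understood in the same way. *)

theory Defs
  imports
    "HOL-Library.Z2"
    "HOL-Computational_Algebra.Computational_Algebra"
    "HOL-Computational_Algebra.Field_as_Ring"
    "HOL-Algebra.QuotRing"
    "Jordan_Normal_Form.DL_Rank"
begin

text \<open>The field \<open>\<bbbF>\<^sub>2\<close> is \<^typ>\<open>bit\<close>. The instances below are the ones the library
  provides for the other fields; they make \<^const>\<open>gcd\<close> available on \<^typ>\<open>bit poly\<close>.\<close>

instantiation bit ::
  "{unique_euclidean_ring, normalization_euclidean_semiring, normalization_semidom_multiplicative}"
begin

definition [simp]: "normalize_bit = (normalize_field :: bit \<Rightarrow> _)"
definition [simp]: "unit_factor_bit = (unit_factor_field :: bit \<Rightarrow> _)"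
definition [simp]: "euclidean_size_bit = (euclidean_size_field :: bit \<Rightarrow> _)"
definition [simp]: "division_segment (x :: bit) = 1"

instance
  by standard
    (simp_all add: dvd_field_iff field_split_simps split: if_splits)

end

instantiation bit :: euclidean_ring_gcd
begin

definition gcd_bit :: "bit \<Rightarrow> bit \<Rightarrow> bit" where
  "gcd_bit = Euclidean_Algorithm.gcd"
definition lcm_bit :: "bit \<Rightarrow> bit \<Rightarrow> bit" where
  "lcm_bit = Euclidean_Algorithm.lcm"
definition Gcd_bit :: "bit set \<Rightarrow> bit" where
  "Gcd_bit = Euclidean_Algorithm.Gcd"
definition Lcm_bit :: "bit set \<Rightarrow> bit" where
  "Lcm_bit = Euclidean_Algorithm.Lcm"

instance
  by standard (simp_all add: gcd_bit_def lcm_bit_def Gcd_bit_def Lcm_bit_def)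

end

instance bit :: field_gcd ..

definition x_pow_minus_one :: "nat \<Rightarrow> bit poly" where
  "x_pow_minus_one l = monom 1 l - 1"

abbreviation F2X :: "bit poly ring" where
  "F2X \<equiv> class_ring"

definition cyclic_ring :: "nat \<Rightarrow> bit poly set ring" where
  "cyclic_ring l = F2X Quot (PIdl\<^bsub>F2X\<^esub> (x_pow_minus_one l))"

definition residue_class :: "nat \<Rightarrow> bit poly \<Rightarrow> bit poly set" where
  "residue_class l p = (PIdl\<^bsub>F2X\<^esub> (x_pow_minus_one l)) +>\<^bsub>F2X\<^esub> p"

text \<open>Elements of \<open>cyclic_ring l\<close> are cosets, so the polynomial representatives of \<open>a\<close> are exactly
  the members of \<open>a\<close>. For \<open>l > 0\<close> there is exactly one of degree less than \<open>l\<close>;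
  its coefficients are the coordinates of \<open>a\<close> in the monomial basis of \<open>cyclic_ring l\<close>.\<close>

definition reduced_rep :: "nat \<Rightarrow> bit poly set \<Rightarrow> bit poly" where
  "reduced_rep l a = (THE p. p \<in> a \<and> degree p < l)"

text \<open>Coordinates are column vectors: column \<open>j\<close> is the image of the \<open>j\<close>-th power of \<open>x\<close>.\<close>

definition shift_mat :: "nat \<Rightarrow> bit mat" where
  "shift_mat l = mat l l (\<lambda>(i, j). if i = (j + 1) mod l then 1 else 0)"

definition circ :: "nat \<Rightarrow> bit poly set \<Rightarrow> bit mat" where
  "circ l a = mat l l (\<lambda>(i, j).
     \<Sum>m<l. coeff (reduced_rep l a) m * (shift_mat l ^\<^sub>m m) $$ (i, j))"

text \<open>\<open>hcat A B\<close> is the block matrix \<open>[A | B]\<close> (the lower blocks have no rows).\<close>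

definition hcat :: "'a::zero mat \<Rightarrow> 'a mat \<Rightarrow> 'a mat" where
  "hcat A B = four_block_mat A B (0\<^sub>m 0 (dim_col A)) (0\<^sub>m 0 (dim_col B))"

definition H_X :: "nat \<Rightarrow> bit poly set \<Rightarrow> bit poly set \<Rightarrow> bit mat" where
  "H_X l a b = hcat (circ l a) (circ l b)"

definition H_Z :: "nat \<Rightarrow> bit poly set \<Rightarrow> bit poly set \<Rightarrow> bit mat" where
  "H_Z l a b = hcat (transpose_mat (circ l b)) (transpose_mat (circ l a))"

text \<open>The first argument of \<^const>\<open>vec_space.rank\<close> is the number of rows. The dimension is an
  integer so that subtraction is not truncated.\<close>

definition bicycle_dim :: "nat \<Rightarrow> bit poly set \<Rightarrow> bit poly set \<Rightarrow> int" where
  "bicycle_dim l a b =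
     2 * int l - int (vec_space.rank l (H_X l a b)) - int (vec_space.rank l (H_Z l a b))"


lemma cring_F2X: "cring F2X"
proof (rule cringI)
  show "abelian_group F2X"
    by (rule abelian_groupI) (auto simp: class_ring_simps intro: exI[of _ "- _"])
  show "comm_monoid F2X"
    by (rule comm_monoidI) (auto simp: class_ring_simps)
qed (auto simp: class_ring_simps algebra_simps)

lemma mem_residue_class_iff: "p \<in> residue_class l q \<longleftrightarrow> x_pow_minus_one l dvd p - q"
proof -
  have "p \<in> residue_class l q \<longleftrightarrow> (\<exists>k. p = k * x_pow_minus_one l + q)"
    by (auto simp: residue_class_def a_r_coset_def' cgenideal_def class_ring_simps)
  also have "\<dots> \<longleftrightarrow> x_pow_minus_one l dvd p - q"
    by (metis add_diff_cancel_right' diff_add_cancel dvd_def mult.commute)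
  finally show ?thesis .
qed

lemma carrier_cyclic_ring: "carrier (cyclic_ring l) = range (residue_class l)"
  by (auto simp: cyclic_ring_def FactRing_def A_RCOSETS_def' class_ring_simps residue_class_def)

lemma residue_class_mult:
  "residue_class l p \<otimes>\<^bsub>cyclic_ring l\<^esub> residue_class l q = residue_class l (p * q)"
proof -
  interpret cring F2X by (rule cring_F2X)
  interpret ideal "PIdl\<^bsub>F2X\<^esub> (x_pow_minus_one l)" F2X
    by (rule cring.cgenideal_ideal[OF cring_F2X]) (simp add: class_ring_simps)
  show ?thesis
    using rcoset_mult_add[of p q]
    by (simp add: cyclic_ring_def FactRing_def residue_class_def class_ring_simps)
qed

lemma degree_x_pow_minus_one: "degree (x_pow_minus_one l) = l"
proof (cases "l = 0")
  case False
  then have "degree (monom (1::bit) l + (- 1)) = degree (monom (1::bit) l)"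
    by (intro degree_add_eq_left) (simp add: degree_monom_eq del: uminus_bit_def)
  then show ?thesis
    by (simp add: x_pow_minus_one_def degree_monom_eq)
qed (simp add: x_pow_minus_one_def)

lemma reduced_rep_residue_class:
  assumes "l > 0"
  shows "reduced_rep l (residue_class l p) = p mod x_pow_minus_one l"
  unfolding reduced_rep_def mem_residue_class_iff
proof (rule the_equality)
  let ?m = "x_pow_minus_one l"
  have m0: "?m \<noteq> 0"
    using assms degree_x_pow_minus_one[of l] by auto
  have "?m dvd p mod ?m - p"
    by (metis dvd_minus_mod dvd_diff_commute)
  moreover have "degree (p mod ?m) < l"
    using degree_mod_less'[of ?m p] m0 assms degree_x_pow_minus_one[of l]
    by (cases "p mod ?m = 0") auto
  ultimately show "?m dvd p mod ?m - p \<and> degree (p mod ?m) < l"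
    by simp
  fix q assume q: "?m dvd q - p \<and> degree q < l"
  then have "q mod ?m = p mod ?m"
    using mod_eq_dvd_iff by metis
  then show "q = p mod ?m"
    using q mod_poly_less[of q ?m] by (simp add: degree_x_pow_minus_one)
qed

end

theory Submission
  imports Defs
begin

text \<open>The column space of \<open>H\<^sub>X\<close> is the ideal of \<open>R\<close> generated by \<open>a\<close> and \<open>b\<close>, that is, by
  \<open>h = gcd(a, b, x\<^sup>l - 1)\<close>, and the \<open>l - deg h\<close> products \<open>h x\<^sup>j\<close> of degree less than \<open>l\<close> form a basis of it.
  The substitution \<open>x \<mapsto> x\<^sup>-\<^sup>1\<close> turns the column space of \<open>H\<^sub>X\<close> into that of \<open>H\<^sub>Z\<close>, so both ranks are
  \<open>l - deg h\<close> and \<open>k = 2 deg h\<close>. For \<open>a = g u\<close>, \<open>b = g v\<close> one has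
  \<open>deg h = deg g + deg gcd(u, v, (x\<^sup>l - 1)/g)\<close>, so the upper bound is attained.\<close>

section \<open>Rank and column space\<close>

lemma mult_mat_vec_unit_vec:
  assumes "A \<in> carrier_mat n nc" and "j < nc"
  shows "A *\<^sub>v unit_vec nc j = (col A j :: 'a :: comm_ring_1 vec)"
  using assms by (intro eq_vecI) auto

text \<open>Linear independence concerns the set of columns, so repeated columns are excluded first:
  they would put a difference of two unit vectors into the kernel. A nontrivial relation between
  distinct columns is a kernel vector as well.\<close>

lemma (in vec_space) rank_eq_dim_col_of_injective:
  assumes N: "N \<in> carrier_mat n r"
    and inj: "\<And>z. z \<in> carrier_vec r \<Longrightarrow> N *\<^sub>v z = 0\<^sub>v n \<Longrightarrow> z = 0\<^sub>v r"
  shows "rank N = r"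
proof -
  have "distinct (cols N)"
  proof (rule ccontr)
    assume "\<not> distinct (cols N)"
    then obtain i j where ij: "i < r" "j < r" "i \<noteq> j" "col N i = col N j"
      using N by (auto simp: distinct_conv_nth)
    have "N *\<^sub>v (unit_vec r i - unit_vec r j) = N *\<^sub>v unit_vec r i - N *\<^sub>v unit_vec r j"
      by (rule mult_minus_distrib_mat_vec[OF N]) auto
    also have "\<dots> = 0\<^sub>v n"
      using ij N by (auto simp: mult_mat_vec_unit_vec[OF N])
    finally have "(unit_vec r i - unit_vec r j :: 'a vec) = 0\<^sub>v r"
      by (rule inj[rotated]) simp
    then have "(unit_vec r i - unit_vec r j) $ i = (0\<^sub>v r :: 'a vec) $ i"
      by simp
    with ij show False
      by simp
  qed
  moreover have "lin_indpt (set (cols N))"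
    using lin_depE[OF N _ \<open>distinct (cols N)\<close>] inj by metis
  ultimately show ?thesis
    by (rule lin_indpt_full_rank[OF N])
qed

text \<open>Rank is the dimension of the column space, so \<open>A\<close> may be replaced by a
  matrix \<open>N\<close> whose columns form a basis of the same space.\<close>

lemma (in vec_space) rank_eq_of_same_range:
  assumes A: "A \<in> carrier_mat n nc" and N: "N \<in> carrier_mat n r"
    and range: "(\<lambda>x. A *\<^sub>v x) ` carrier_vec nc = (\<lambda>z. N *\<^sub>v z) ` carrier_vec r"
    and inj: "\<And>z. z \<in> carrier_vec r \<Longrightarrow> N *\<^sub>v z = 0\<^sub>v n \<Longrightarrow> z = 0\<^sub>v r"
  shows "rank A = r"
proof -
  have "col_space A = (\<lambda>x. A *\<^sub>v x) ` carrier_vec nc"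
    using A by (auto simp: col_space_eq[OF A])
  moreover have "col_space N = (\<lambda>x. N *\<^sub>v x) ` carrier_vec r"
    using N by (auto simp: col_space_eq[OF N])
  ultimately have "span (set (cols A)) = span (set (cols N))"
    using range by (simp add: col_space_def)
  then have "rank A = rank N"
    by (simp add: rank_def)
  with rank_eq_dim_col_of_injective[OF N inj] show ?thesis
    by simp
qed

section \<open>Block matrices with two blocks side by side\<close>

lemma hcat_mult_vec:
  assumes A: "A \<in> carrier_mat n k1" and B: "B \<in> carrier_mat n k2"
    and x: "x \<in> carrier_vec k1" and y: "y \<in> carrier_vec k2"
  shows "hcat A B *\<^sub>v (x @\<^sub>v y) = A *\<^sub>v x + B *\<^sub>v (y :: 'a :: comm_ring_1 vec)"
proof -
  \<comment> \<open>The lower blocks have no rows and contribute only a vector of dimension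
    0.\<close>
  have "hcat A B *\<^sub>v (x @\<^sub>v y) = (A *\<^sub>v x + B *\<^sub>v y) @\<^sub>v (0\<^sub>m 0 k1 *\<^sub>v x + 0\<^sub>m 0 k2 *\<^sub>v y)"
    unfolding hcat_def using A B x y
    by (subst four_block_mat_mult_vec[of A n k1 B k2 _ 0]) auto
  also have "\<dots> = A *\<^sub>v x + B *\<^sub>v y"
    using A B by (intro eq_vecI) auto
  finally show ?thesis .
qed

lemma hcat_carrier:
  assumes "A \<in> carrier_mat n k1" and "B \<in> carrier_mat n k2"
  shows "hcat A B \<in> carrier_mat n (k1 + k2)"
  using assms by (auto simp: hcat_def)

lemma range_hcat:
  fixes A B :: "'a :: comm_ring_1 mat"
  assumes A: "A \<in> carrier_mat n k1" and B: "B \<in> carrier_mat n k2"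
  shows "(\<lambda>x. hcat A B *\<^sub>v x) ` carrier_vec (k1 + k2)
    = {A *\<^sub>v x + B *\<^sub>v y | x y. x \<in> carrier_vec k1 \<and> y \<in> carrier_vec k2}"
proof (intro equalityI subsetI)
  fix w assume "w \<in> (\<lambda>x. hcat A B *\<^sub>v x) ` carrier_vec (k1 + k2)"
  then obtain z where z: "z \<in> carrier_vec (k1 + k2)" "w = hcat A B *\<^sub>v z"
    by auto
  have "z = vec_first z k1 @\<^sub>v vec_last z k2"
    using z by simp
  then have "w = A *\<^sub>v vec_first z k1 + B *\<^sub>v vec_last z k2"
    using hcat_mult_vec[OF A B, of "vec_first z k1" "vec_last z k2"] z by simp
  then show "w \<in> {A *\<^sub>v x + B *\<^sub>v y | x y. x \<in> carrier_vec k1 \<and> y \<in> carrier_vec k2}"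
    using vec_first_carrier vec_last_carrier by blast
next
  fix w assume "w \<in> {A *\<^sub>v x + B *\<^sub>v y | x y. x \<in> carrier_vec k1 \<and> y \<in> carrier_vec k2}"
  then obtain x y where "w = A *\<^sub>v x + B *\<^sub>v y" "x \<in> carrier_vec k1" "y \<in> carrier_vec k2"
    by auto
  then show "w \<in> (\<lambda>x. hcat A B *\<^sub>v x) ` carrier_vec (k1 + k2)"
    using hcat_mult_vec[OF A B] by (intro image_eqI[of _ _ "x @\<^sub>v y"]) auto
qed

section \<open>Circulant matrices as multiplication operators\<close>

definition poly_of_coords :: "'a :: comm_ring_1 vec \<Rightarrow> 'a poly" where
  "poly_of_coords v = (\<Sum>j<dim_vec v. monom (v $ j) j)"

definition coords :: "nat \<Rightarrow> 'a :: comm_ring_1 poly \<Rightarrow> 'a vec" where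
  "coords n p = vec n (coeff p)"

lemma coords_carrier [simp]: "coords n p \<in> carrier_vec n"
  by (simp add: coords_def)

lemma dim_coords [simp]: "dim_vec (coords n p) = n"
  by (simp add: coords_def)

lemma coords_add: "coords n (p + q) = coords n p + coords n q"
  by (auto simp: coords_def)

lemma coeff_poly_of_coords:
  "coeff (poly_of_coords v) i = (if i < dim_vec v then v $ i else 0)"
  by (simp add: poly_of_coords_def coeff_sum if_distrib sum.delta cong: if_cong)

lemma coords_poly_of_coords: "v \<in> carrier_vec n \<Longrightarrow> coords n (poly_of_coords v) = v"
  by (auto simp: coords_def coeff_poly_of_coords)

text \<open>The zero polynomial has degree 0, which is not below \<open>n\<close> when
  \<open>n = 0\<close>; that case occurs later with \<open>n = l - degree h\<close>.\<close>

lemma degree_poly_of_coords: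
  assumes "v \<in> carrier_vec n" and "poly_of_coords v \<noteq> 0"
  shows "degree (poly_of_coords v) < n"
proof (rule ccontr)
  assume "\<not> degree (poly_of_coords v) < n"
  then have "lead_coeff (poly_of_coords v) = 0"
    using assms(1) by (simp add: coeff_poly_of_coords)
  with assms(2) show False
    by simp
qed

lemma poly_of_coords_coords:
  assumes "p = 0 \<or> degree p < n"
  shows "poly_of_coords (coords n p) = p"
  using assms by (intro poly_eqI) (auto simp: coeff_poly_of_coords coords_def coeff_eq_0)

lemma coeff_sum_smult_mod:
  fixes f :: "'b \<Rightarrow> 'a :: field poly"
  shows "coeff ((\<Sum>i\<in>A. Polynomial.smult (c i) (f i)) mod M) k = (\<Sum>i\<in>A. c i * coeff (f i mod M) k)"
  by (induction A rule: infinite_finite_induct) (simp_all add: poly_mod_add_left mod_smult_left)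

text \<open>Column \<open>j\<close> holds h x^j mod M, and reduction modulo \<open>M\<close> is
  linear over the field, so combining the columns with weights \<open>z\<close> multiplies
  \<open>h\<close> by the polynomial of \<open>z\<close>. Modulus 0 is allowed and means no
  reduction.\<close>

lemma mat_mult_vec_coords:
  fixes h :: "'a :: field poly"
  assumes "z \<in> carrier_vec r"
  shows "mat n r (\<lambda>(i, j). coeff (h * monom 1 j mod M) i) *\<^sub>v z
    = coords n (h * poly_of_coords z mod M)"
proof (rule eq_vecI)
  fix i assume "i < dim_vec (coords n (h * poly_of_coords z mod M))"
  then have i: "i < n"
    by simp
  have "h * poly_of_coords z = (\<Sum>j<r. Polynomial.smult (z $ j) (h * monom 1 j))"
    using assms by (simp add: poly_of_coords_def sum_distrib_left smult_monom flip: mult_smult_right)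
  then show "(mat n r (\<lambda>(i, j). coeff (h * monom 1 j mod M) i) *\<^sub>v z) $ i
      = coords n (h * poly_of_coords z mod M) $ i"
    using i assms
    by (simp add: coords_def coeff_sum_smult_mod scalar_prod_def lessThan_atLeast0 mult.commute)
qed simp

section \<open>Powers of the cyclic shift and circulant matrices\<close>

lemma shift_mat_power:
  assumes "l > 0"
  shows "shift_mat l ^\<^sub>m k = mat l l (\<lambda>(i, j). if i = (j + k) mod l then 1 else 0)"
proof (induction k)
  case 0
  show ?case
    by (rule eq_matI) (auto simp: shift_mat_def)
next
  case (Suc k)
  show ?case
  proof (rule eq_matI)
    fix i j assume "i < dim_row (mat l l (\<lambda>(i, j). if i = (j + Suc k) mod l then 1 else (0::bit)))"
      "j < dim_col (mat l l (\<lambda>(i, j). if i = (j + Suc k) mod l then 1 else (0::bit)))"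
    then have ij: "i < l" "j < l"
      by auto
    have "dim_row (shift_mat l ^\<^sub>m k) = l" "dim_col (shift_mat l ^\<^sub>m k) = l"
      by (simp_all add: Suc)
    then have "(shift_mat l ^\<^sub>m Suc k) $$ (i, j)
        = (\<Sum>t<l. (shift_mat l ^\<^sub>m k) $$ (i, t) * shift_mat l $$ (t, j))"
      using ij by (simp add: scalar_prod_def lessThan_atLeast0 shift_mat_def)
    also have "\<dots> = (\<Sum>t<l. (if i = (t + k) mod l then 1 else 0) * (if t = (j + 1) mod l then 1 else 0))"
      using ij by (intro sum.cong) (auto simp: Suc, auto simp: shift_mat_def)
    also have "\<dots> = (\<Sum>t<l. if t = (j + 1) mod l then (if i = (t + k) mod l then 1 else 0) else 0)"
      by (intro sum.cong) auto
    also have "\<dots> = (if i = (j + Suc k) mod l then 1 else 0)"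
      using assms by (simp add: sum.delta mod_simps)
    finally show "(shift_mat l ^\<^sub>m Suc k) $$ (i, j)
        = mat l l (\<lambda>(i, j). if i = (j + Suc k) mod l then 1 else 0) $$ (i, j)"
      using ij by simp
  qed (auto simp: shift_mat_def)
qed

text \<open>Since x^l is congruent to 1, only the remainder of \<open>n\<close> modulo
  \<open>l\<close> survives in the exponent, and that monomial is already reduced.\<close>

lemma monom_mod_x_pow_minus_one:
  assumes "l > 0"
  shows "monom 1 n mod x_pow_minus_one l = monom 1 (n mod l)"
proof -
  let ?M = "x_pow_minus_one l"
  have "monom 1 l mod ?M = 1 mod ?M"
    unfolding mod_eq_dvd_iff by (simp add: x_pow_minus_one_def del: minus_bit_def)
  then have "monom 1 l ^ (n div l) mod ?M = 1 ^ (n div l) mod ?M"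
    by (metis power_mod)
  then have "monom 1 l ^ (n div l) * monom 1 (n mod l) mod ?M = 1 * monom 1 (n mod l) mod ?M"
    by (metis mod_mult_left_eq power_one)
  moreover have "monom (1::bit) n = monom 1 l ^ (n div l) * monom 1 (n mod l)"
    by (simp add: monom_power mult_monom)
  moreover have "monom 1 (n mod l) mod ?M = monom 1 (n mod l)"
    using assms by (intro mod_poly_less) (simp add: degree_monom_eq degree_x_pow_minus_one)
  ultimately show ?thesis
    by simp
qed

lemma circ_entry:
  assumes "l > 0" and "i < l" and "j < l"
  shows "circ l a $$ (i, j)
    = (\<Sum>k<l. coeff (reduced_rep l a) k * (if i = (j + k) mod l then 1 else 0))"
  using assms by (simp add: circ_def shift_mat_power)

lemma circ_carrier: "circ l a \<in> carrier_mat l l"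
  by (simp add: circ_def)

text \<open>Expand the reduced representative into monomials: x^k x^j reduces to x^((j + k) mod l),
  which is where column \<open>j\<close> of the \<open>k\<close>-th power of the shift has its only
  1.\<close>

lemma circ_residue_class:
  assumes "l > 0"
  shows "circ l (residue_class l p)
    = mat l l (\<lambda>(i, j). coeff (p * monom 1 j mod x_pow_minus_one l) i)"
proof (rule eq_matI)
  let ?M = "x_pow_minus_one l" and ?N = "mat l l (\<lambda>(i, j). coeff (p * monom 1 j mod x_pow_minus_one l) i)"
  fix i j assume "i < dim_row ?N" "j < dim_col ?N"
  then have ij: "i < l" "j < l"
    by auto
  have "?M \<noteq> 0"
    using assms degree_x_pow_minus_one[of l] by auto
  then have "p mod ?M = 0 \<or> degree (p mod ?M) < l"
    using degree_mod_less[of ?M p] by (auto simp: degree_x_pow_minus_one)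
  then have "p mod ?M = poly_of_coords (coords l (p mod ?M))"
    by (simp add: poly_of_coords_coords)
  also have "\<dots> = (\<Sum>k<l. monom (coeff (p mod ?M) k) k)"
    by (simp add: poly_of_coords_def coords_def)
  finally have "(p mod ?M) * monom 1 j = (\<Sum>k<l. monom (coeff (p mod ?M) k) k) * monom 1 j"
    by (rule arg_cong)
  also have "\<dots> = (\<Sum>k<l. Polynomial.smult (coeff (p mod ?M) k) (monom 1 (j + k)))" (is "_ = ?S")
    by (simp add: sum_distrib_right mult_monom smult_monom add.commute)
  finally have S: "(p mod ?M) * monom 1 j = ?S" .
  have "coeff (p * monom 1 j mod ?M) i = coeff ((p mod ?M) * monom 1 j mod ?M) i"
    by (simp only: mod_mult_left_eq)
  also have "\<dots> = (\<Sum>k<l. coeff (p mod ?M) k * coeff (monom 1 (j + k) mod ?M) i)"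
    by (simp only: S coeff_sum_smult_mod)
  also have "\<dots> = (\<Sum>k<l. coeff (p mod ?M) k * (if i = (j + k) mod l then 1 else 0))"
    using assms by (intro sum.cong) (auto simp: monom_mod_x_pow_minus_one coeff_monom)
  also have "\<dots> = circ l (residue_class l p) $$ (i, j)"
    using assms ij by (simp only: circ_entry reduced_rep_residue_class)
  finally show "circ l (residue_class l p) $$ (i, j) = ?N $$ (i, j)"
    using ij by simp
qed (auto simp: circ_def)

lemma circ_mult_vec:
  assumes "l > 0" and "x \<in> carrier_vec l"
  shows "circ l (residue_class l p) *\<^sub>v x = coords l (p * poly_of_coords x mod x_pow_minus_one l)"
  using assms by (simp add: circ_residue_class mat_mult_vec_coords)

text \<open>\<open>flip\<close> is the coordinate form of the substitution \<open>x \<mapsto> x\<^sup>-\<^sup>1\<close>, which conjugates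
  a circulant matrix into its transpose.\<close>

definition flip :: "nat \<Rightarrow> 'a vec \<Rightarrow> 'a vec" where
  "flip l v = vec l (\<lambda>i. v $ ((l - i) mod l))"

lemma flip_carrier [simp]: "flip l v \<in> carrier_vec l"
  by (simp add: flip_def)

lemma neg_neg_mod:
  fixes i l :: nat
  assumes "i < l"
  shows "(l - (l - i) mod l) mod l = i"
  using assms by (cases "i = 0") auto

lemma flip_flip: "v \<in> carrier_vec l \<Longrightarrow> flip l (flip l v) = v"
  by (intro eq_vecI) (auto simp: flip_def neg_neg_mod)

lemma flip_add:
  "v \<in> carrier_vec l \<Longrightarrow> w \<in> carrier_vec l \<Longrightarrow> flip l (v + w) = flip l v + flip l w"
  by (intro eq_vecI) (auto simp: flip_def)

text \<open>A circulant entry depends only on the difference of its indices modulo \<open>l\<close>,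
  and (-i) - (-j) = j - i. Here \<open>(l - i) mod l\<close> is the residue of -i.\<close>

lemma circ_flip_entry:
  assumes "i < l" and "j < l"
  shows "circ l a $$ ((l - i) mod l, (l - j) mod l) = circ l a $$ (j, i)"
proof -
  have "(l - i) mod l = ((l - j) mod l + k) mod l \<longleftrightarrow> j = (i + k) mod l" if "k < l" for k
  proof -
    \<comment> \<open>Each residue is written out by cases, which removes the wrap-around and leaves
      linear arithmetic.\<close>
    have "((l - j) mod l + k) mod l = (if j = 0 then k else if k < j then l - j + k else k - j)"
      using that assms by (auto simp: mod_if)
    moreover have "(l - i) mod l = (if i = 0 then 0 else l - i)"
      using assms by auto
    moreover have "(i + k) mod l = (if i + k < l then i + k else i + k - l)"
      using that assms by (auto simp: mod_if)
    ultimately show ?thesis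
      using that assms by (auto split: if_splits)
  qed
  then show ?thesis
    using assms by (auto simp: circ_entry intro!: sum.cong)
qed

lemma transpose_circ_mult_vec:
  assumes "x \<in> carrier_vec l"
  shows "transpose_mat (circ l a) *\<^sub>v x = flip l (circ l a *\<^sub>v flip l x)"
proof (rule eq_vecI)
  fix i assume "i < dim_vec (flip l (circ l a *\<^sub>v flip l x))"
  then have i: "i < l"
    by (simp add: flip_def)
  have "(transpose_mat (circ l a) *\<^sub>v x) $ i = (\<Sum>j<l. circ l a $$ (j, i) * x $ j)"
    using i assms by (simp add: scalar_prod_def lessThan_atLeast0 circ_def)
  also have "\<dots> = (\<Sum>j<l. circ l a $$ ((l - i) mod l, (l - j) mod l) * x $ j)"
    using i by (intro sum.cong) (auto simp: circ_flip_entry)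
  \<comment> \<open>Negation modulo \<open>l\<close> is an involution on the indices, hence its own
    inverse in the reindexing.\<close>
  also have "\<dots> = (\<Sum>j<l. circ l a $$ ((l - i) mod l, j) * x $ ((l - j) mod l))"
    using i by (intro sum.reindex_bij_witness[of _ "\<lambda>j. (l - j) mod l" "\<lambda>j. (l - j) mod l"])
      (auto simp: neg_neg_mod)
  also have "\<dots> = flip l (circ l a *\<^sub>v flip l x) $ i"
    using i by (simp add: scalar_prod_def lessThan_atLeast0 circ_def flip_def)
  finally show "(transpose_mat (circ l a) *\<^sub>v x) $ i = flip l (circ l a *\<^sub>v flip l x) $ i" .
qed (simp add: flip_def circ_def)

section \<open>The ideal generated by two elements\<close>

text \<open>Bezout for the outer and the inner gcd, combined.\<close>

lemma gcd_representation:
  fixes p q M :: "'a :: field_gcd poly"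
  obtains s t w where "gcd p (gcd q M) = p * s + q * t + M * w"
proof -
  obtain s s' where 1: "s * p + s' * gcd q M = gcd p (gcd q M)"
    by (metis bezout_coefficients_fst_snd)
  obtain t w where 2: "t * q + w * M = gcd q M"
    by (metis bezout_coefficients_fst_snd)
  have "gcd p (gcd q M) = s * p + s' * (t * q + w * M)"
    using 1 2 by simp
  also have "\<dots> = p * s + q * (s' * t) + M * (s' * w)"
    by (simp add: algebra_simps)
  finally have "gcd p (gcd q M) = p * s + q * (s' * t) + M * (s' * w)" .
  then show ?thesis
    by (rule that)
qed

text \<open>Modulo \<open>M\<close>, the ideal generated by \<open>p\<close> and \<open>q\<close> is
  generated by \<open>h\<close>. As \<open>h\<close> divides \<open>M\<close>, its reduced elements
  are genuine multiples of \<open>h\<close>, and the degree bound leaves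
  \<open>degree M - degree h\<close> free coefficients for the cofactor.\<close>

lemma sums_mod_eq_multiples_of_gcd:
  fixes p q M :: "'a :: field_gcd poly"
  assumes M: "M \<noteq> 0"
  defines "h \<equiv> gcd p (gcd q M)"
  shows "{coords (degree M) (p * poly_of_coords x mod M) + coords (degree M) (q * poly_of_coords y mod M) | x y.
            x \<in> carrier_vec (degree M) \<and> y \<in> carrier_vec (degree M)}
    = (\<lambda>z. coords (degree M) (h * poly_of_coords z)) ` carrier_vec (degree M - degree h)" (is "?L = ?R")
proof -
  have h0: "h \<noteq> 0" and hM: "h dvd M"
    using M unfolding h_def by (simp, metis dvd_trans gcd_dvd2)
  have hp: "h dvd p" and hq: "h dvd q"
    unfolding h_def by (simp, metis dvd_trans gcd_dvd1 gcd_dvd2)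
  show ?thesis
  proof (intro equalityI subsetI)
    fix w assume "w \<in> ?L"
    then obtain x y where w: "w = coords (degree M) ((p * poly_of_coords x + q * poly_of_coords y) mod M)"
      by (auto simp: poly_mod_add_left simp flip: coords_add)
    let ?s = "(p * poly_of_coords x + q * poly_of_coords y) mod M"
    \<comment> \<open>Reduction modulo a multiple of \<open>h\<close> preserves divisibility by
      \<open>h\<close>.\<close>
    have "h dvd ?s"
      using hM hp hq by (simp add: dvd_mod_iff)
    then obtain Z where Z: "?s = h * Z"
      by (elim dvdE)
    have "Z = 0 \<or> degree Z < degree M - degree h"
      using degree_mod_less[OF M, of "p * poly_of_coords x + q * poly_of_coords y"] h0 Z
      by (cases "Z = 0") (auto simp: degree_mult_eq)
    then have "w = coords (degree M) (h * poly_of_coords (coords (degree M - degree h) Z))"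
      by (simp add: w Z poly_of_coords_coords)
    then show "w \<in> ?R"
      by (intro image_eqI[of _ _ "coords (degree M - degree h) Z"]) auto
  next
    fix w assume "w \<in> ?R"
    then obtain z where z: "z \<in> carrier_vec (degree M - degree h)"
      and w: "w = coords (degree M) (h * poly_of_coords z)"
      by auto
    obtain s t u where stu: "h = p * s + q * t + M * u"
      unfolding h_def by (rule gcd_representation)
    let ?Z = "poly_of_coords z"
    have red: "poly_of_coords (coords (degree M) (r mod M)) = r mod M" for r
      using degree_mod_less[OF M, of r] by (auto intro: poly_of_coords_coords)
    have "h * ?Z mod M = h * ?Z"
    proof (cases "?Z = 0")
      case False
      then show ?thesis
        using degree_poly_of_coords[OF z] h0 by (intro mod_poly_less) (simp add: degree_mult_eq)
    qed simp
    \<comment> \<open>The multiple of \<open>M\<close> in the Bezout identity vanishes modulo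
      \<open>M\<close>.\<close>
    moreover have "h * ?Z mod M = (p * (s * ?Z) + q * (t * ?Z)) mod M"
      unfolding stu mod_eq_dvd_iff by (simp add: algebra_simps)
    \<comment> \<open>The cofactors are reduced so that they come from coordinate vectors of
      dimension \<open>degree M\<close>.\<close>
    moreover have "\<dots> = p * (s * ?Z mod M) mod M + q * (t * ?Z mod M) mod M"
      by (simp add: poly_mod_add_left mod_mult_right_eq)
    ultimately have hZ: "h * ?Z = p * (s * ?Z mod M) mod M + q * (t * ?Z mod M) mod M"
      by simp
    have "w = coords (degree M) (p * (s * ?Z mod M) mod M) + coords (degree M) (q * (t * ?Z mod M) mod M)"
      by (simp only: w hZ coords_add)
    then show "w \<in> ?L"
      by (intro CollectI exI[of _ "coords (degree M) (s * ?Z mod M)"]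
          exI[of _ "coords (degree M) (t * ?Z mod M)"]) (simp add: red)
  qed
qed

section \<open>The dimension formula\<close>

text \<open>For \<open>h\<close> dividing x^l - 1 this is the transposed generator matrix of the
  cyclic code generated by \<open>h\<close>. The number of columns keeps every h x^j below degree
  \<open>l\<close>.\<close>

definition gen_mat :: "nat \<Rightarrow> bit poly \<Rightarrow> bit mat" where
  "gen_mat l h = mat l (l - degree h) (\<lambda>(i, j). coeff (h * monom 1 j) i)"

text \<open>The rows of \<open>gen_mat\<close> permuted by i -> -i mod l, as required for the column
  space of \<open>H_Z\<close>.\<close>

definition flip_gen_mat :: "nat \<Rightarrow> bit poly \<Rightarrow> bit mat" where
  "flip_gen_mat l h = mat l (l - degree h) (\<lambda>(i, j). gen_mat l h $$ ((l - i) mod l, j))"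

lemma gen_mat_mult_vec:
  assumes "z \<in> carrier_vec (l - degree h)"
  shows "gen_mat l h *\<^sub>v z = coords l (h * poly_of_coords z)"
  \<comment> \<open>Modulus 0 leaves the product unreduced.\<close>
  using mat_mult_vec_coords[OF assms, of l h 0] by (simp add: gen_mat_def)

lemma flip_gen_mat_mult_vec:
  assumes "z \<in> carrier_vec (l - degree h)"
  shows "flip_gen_mat l h *\<^sub>v z = flip l (gen_mat l h *\<^sub>v z)"
  using assms by (intro eq_vecI) (auto simp: flip_gen_mat_def gen_mat_def flip_def scalar_prod_def)

text \<open>The product of \<open>h\<close> and the polynomial of \<open>z\<close> has degree below
  \<open>l\<close>, so its \<open>l\<close> coordinates determine it; if they vanish, the product is
  0 in an integral domain.\<close>

lemma gen_mat_injective: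
  assumes z: "z \<in> carrier_vec (l - degree h)" and "h \<noteq> 0" and 0: "gen_mat l h *\<^sub>v z = 0\<^sub>v l"
  shows "z = 0\<^sub>v (l - degree h)"
proof -
  have "h * poly_of_coords z = poly_of_coords (coords l (h * poly_of_coords z))"
    using degree_poly_of_coords[OF z] assms(2)
    by (intro poly_of_coords_coords[symmetric], cases "poly_of_coords z = 0") (auto simp: degree_mult_eq)
  also have "\<dots> = 0"
    using 0 gen_mat_mult_vec[OF z] by (simp add: poly_of_coords_def)
  finally have "poly_of_coords z = 0"
    using assms(2) by simp
  then show ?thesis
    using coords_poly_of_coords[OF z] by (auto simp: coords_def)
qed

lemma range_gen_mat:
  assumes "l > 0"
  shows "{circ l (residue_class l p) *\<^sub>v x + circ l (residue_class l q) *\<^sub>v y | x y.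
            x \<in> carrier_vec l \<and> y \<in> carrier_vec l}
    = (\<lambda>z. gen_mat l (gcd p (gcd q (x_pow_minus_one l))) *\<^sub>v z)
        ` carrier_vec (l - degree (gcd p (gcd q (x_pow_minus_one l))))"
proof -
  have "x_pow_minus_one l \<noteq> 0"
    using assms degree_x_pow_minus_one[of l] by auto
  note sums_mod_eq_multiples_of_gcd[OF this, of p q, unfolded degree_x_pow_minus_one]
  moreover have "{circ l (residue_class l p) *\<^sub>v x + circ l (residue_class l q) *\<^sub>v y | x y.
        x \<in> carrier_vec l \<and> y \<in> carrier_vec l}
    = {coords l (p * poly_of_coords x mod x_pow_minus_one l)
        + coords l (q * poly_of_coords y mod x_pow_minus_one l) | x y.
        x \<in> carrier_vec l \<and> y \<in> carrier_vec l}"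
    using circ_mult_vec[OF assms] by (intro Collect_cong) metis
  ultimately show ?thesis
    by (simp add: gen_mat_mult_vec cong: image_cong)
qed

section \<open>Ranks of the two check matrices\<close>

lemma rank_H_X:
  assumes "l > 0"
  shows "vec_space.rank l (H_X l (residue_class l p) (residue_class l q))
    = l - degree (gcd p (gcd q (x_pow_minus_one l)))"
proof -
  let ?h = "gcd p (gcd q (x_pow_minus_one l))"
  have h0: "?h \<noteq> 0"
    using assms degree_x_pow_minus_one[of l] by auto
  show ?thesis
  proof (rule vec_space.rank_eq_of_same_range)
    show "H_X l (residue_class l p) (residue_class l q) \<in> carrier_mat l (l + l)"
      unfolding H_X_def by (intro hcat_carrier circ_carrier)
    show "gen_mat l ?h \<in> carrier_mat l (l - degree ?h)"
      by (simp add: gen_mat_def)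
    show "(\<lambda>x. H_X l (residue_class l p) (residue_class l q) *\<^sub>v x) ` carrier_vec (l + l)
        = (\<lambda>z. gen_mat l ?h *\<^sub>v z) ` carrier_vec (l - degree ?h)"
      unfolding H_X_def range_hcat[OF circ_carrier circ_carrier] range_gen_mat[OF assms, symmetric]
      by simp
  qed (rule gen_mat_injective[OF _ h0])
qed

text \<open>Conjugation by the additive involution \<open>flip\<close> turns both circulants into
  their transposes, and the flipped arguments again run through all vectors.\<close>

lemma transpose_circ_range:
  "{transpose_mat (circ l a) *\<^sub>v x + transpose_mat (circ l b) *\<^sub>v y | x y.
      x \<in> carrier_vec l \<and> y \<in> carrier_vec l}
    = flip l ` {circ l a *\<^sub>v x + circ l b *\<^sub>v y | x y. x \<in> carrier_vec l \<and> y \<in> carrier_vec l}"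
    (is "?L = flip l ` ?R")
proof (intro equalityI subsetI)
  have mv: "circ l c *\<^sub>v v \<in> carrier_vec l" if "v \<in> carrier_vec l" for c v
    using that by (rule mult_mat_vec_carrier[OF circ_carrier])
  {
    fix w assume "w \<in> ?L"
    then obtain x y where xy: "x \<in> carrier_vec l" "y \<in> carrier_vec l"
      and "w = transpose_mat (circ l a) *\<^sub>v x + transpose_mat (circ l b) *\<^sub>v y"
      by auto
    then have "w = flip l (circ l a *\<^sub>v flip l x + circ l b *\<^sub>v flip l y)"
      by (simp add: transpose_circ_mult_vec flip_add mv)
    then show "w \<in> flip l ` ?R"
      using flip_carrier by blast
  next
    fix w assume "w \<in> flip l ` ?R"
    then obtain x y where xy: "x \<in> carrier_vec l" "y \<in> carrier_vec l"
      and "w = flip l (circ l a *\<^sub>v x + circ l b *\<^sub>v y)"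
      by auto
    then have "w = transpose_mat (circ l a) *\<^sub>v flip l x + transpose_mat (circ l b) *\<^sub>v flip l y"
      by (simp add: transpose_circ_mult_vec flip_add flip_flip mv)
    then show "w \<in> ?L"
      using flip_carrier by blast
  }
qed

lemma rank_H_Z:
  assumes "l > 0"
  shows "vec_space.rank l (H_Z l (residue_class l p) (residue_class l q))
    = l - degree (gcd p (gcd q (x_pow_minus_one l)))"
proof -
  \<comment> \<open>The block from \<open>q\<close> comes first in \<open>H_Z\<close>, hence the
    exchanged order, which is undone at the end.\<close>
  let ?h = "gcd q (gcd p (x_pow_minus_one l))"
  have h0: "?h \<noteq> 0"
    using assms degree_x_pow_minus_one[of l] by auto
  have c: "transpose_mat (circ l a) \<in> carrier_mat l l" for a
    using circ_carrier by simp
  have "vec_space.rank l (H_Z l (residue_class l p) (residue_class l q)) = l - degree ?h"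
  proof (rule vec_space.rank_eq_of_same_range)
    show "H_Z l (residue_class l p) (residue_class l q) \<in> carrier_mat l (l + l)"
      unfolding H_Z_def by (intro hcat_carrier c)
    show "flip_gen_mat l ?h \<in> carrier_mat l (l - degree ?h)"
      by (simp add: flip_gen_mat_def)
    show "(\<lambda>x. H_Z l (residue_class l p) (residue_class l q) *\<^sub>v x) ` carrier_vec (l + l)
        = (\<lambda>z. flip_gen_mat l ?h *\<^sub>v z) ` carrier_vec (l - degree ?h)"
      unfolding H_Z_def range_hcat[OF c c]
      using transpose_circ_range[of l "residue_class l q" "residue_class l p"]
      by (simp add: range_gen_mat[OF assms] image_image flip_gen_mat_mult_vec cong: image_cong)
    fix z assume z: "z \<in> carrier_vec (l - degree ?h)" and "flip_gen_mat l ?h *\<^sub>v z = 0\<^sub>v l"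
    \<comment> \<open>A second \<open>flip\<close> cancels the first, so injectivity is inherited
      from \<open>gen_mat\<close>.\<close>
    then have "flip l (flip l (gen_mat l ?h *\<^sub>v z)) = flip l (0\<^sub>v l)"
      by (simp add: flip_gen_mat_mult_vec)
    moreover have "flip l (0\<^sub>v l) = (0\<^sub>v l :: bit vec)"
      by (intro eq_vecI) (auto simp: flip_def)
    ultimately have "gen_mat l ?h *\<^sub>v z = 0\<^sub>v l"
      using z by (simp add: flip_flip gen_mat_mult_vec)
    then show "z = 0\<^sub>v (l - degree ?h)"
      by (rule gen_mat_injective[OF z h0])
  qed
  then show ?thesis
    by (simp add: gcd.left_commute)
qed

lemma bicycle_dim_eq:
  assumes "l > 0"
  shows "bicycle_dim l (residue_class l p) (residue_class l q)
    = 2 * int (degree (gcd p (gcd q (x_pow_minus_one l))))"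
proof -
  have "x_pow_minus_one l \<noteq> 0"
    using assms degree_x_pow_minus_one[of l] by auto
  \<comment> \<open>This bound makes the natural-number difference in both ranks an exact integer
    difference.\<close>
  then have "degree (gcd p (gcd q (x_pow_minus_one l))) \<le> degree (x_pow_minus_one l)"
    by (intro dvd_imp_degree_le) (metis dvd_trans gcd_dvd2)
  then show ?thesis
    using rank_H_X[OF assms, of p q] rank_H_Z[OF assms, of p q]
    by (simp add: bicycle_dim_def degree_x_pow_minus_one)
qed

text \<open>Cosets sharing an element coincide; this permits arbitrary representatives in the final
  theorem.\<close>

lemma residue_class_eq_of_mem:
  assumes "a \<in> carrier (cyclic_ring l)" and "p \<in> a"
  shows "a = residue_class l p"
proof -
  obtain q where q: "a = residue_class l q"
    using assms(1) by (auto simp: carrier_cyclic_ring)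
  then have pq: "x_pow_minus_one l dvd p - q"
    using assms(2) by (simp add: mem_residue_class_iff)
  have "x_pow_minus_one l dvd r - q \<longleftrightarrow> x_pow_minus_one l dvd r - p" for r
    using dvd_diff[OF _ pq, of "r - q"] dvd_add[OF _ pq, of "r - p"] by auto
  then show ?thesis
    by (simp add: q set_eq_iff mem_residue_class_iff)
qed

section \<open>Degree of a gcd with a common factor\<close>

lemma degree_normalize: "degree (normalize p) = degree (p :: 'a :: field_gcd poly)"
proof (cases "p = 0")
  case False
  then show ?thesis
    by (intro antisym dvd_imp_degree_le) auto
qed simp

text \<open>The divisor \<open>g\<close> factors out of the nested gcd up to normalization, which
  does not change degrees.\<close>

lemma degree_gcd_mult_dvd:
  fixes g p q M :: "'a :: field_gcd poly"
  assumes "g dvd M" and "M \<noteq> 0"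
  shows "degree (gcd (g * p) (gcd (g * q) M)) = degree g + degree (gcd p (gcd q (M div g)))"
proof -
  obtain M' where M': "M = g * M'"
    using assms(1) by (elim dvdE)
  with assms(2) have nz: "g \<noteq> 0" "M' \<noteq> 0"
    by auto
  have "gcd (g * p) (gcd (g * q) M) = normalize (g * gcd p (gcd q M'))"
    unfolding M' by (metis gcd_mult_left gcd.normalize_right_idem)
  then show ?thesis
    using nz by (simp add: M' degree_mult_eq degree_normalize)
qed

theorem theorem7:
  fixes l :: nat
  assumes "odd l" and "l > 0"
  shows
    "(\<forall>g u v a b.
        g dvd x_pow_minus_one l \<and> u \<in> carrier (cyclic_ring l) \<and> v \<in> carrier (cyclic_ring l)
        \<and> a = residue_class l g \<otimes>\<^bsub>cyclic_ring l\<^esub> u \<and> b = residue_class l g \<otimes>\<^bsub>cyclic_ring l\<^esub> v \<longrightarrow>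
          2 * int (degree g) \<le> bicycle_dim l a b
          \<and> (\<forall>p\<in>u. \<forall>q\<in>v.
               bicycle_dim l a b
                 \<le> 2 * int (degree g) + 2 * int (degree (gcd p (gcd q (x_pow_minus_one l div g)))))
          \<and> (\<forall>p\<in>u. \<forall>q\<in>v.
               \<not> (\<exists>f. irreducible f \<and> f dvd x_pow_minus_one l div g \<and> f dvd p \<and> f dvd q)
               \<longrightarrow> bicycle_dim l a b = 2 * int (degree g)))
     \<and>
     (\<forall>a\<in>carrier (cyclic_ring l). \<forall>b\<in>carrier (cyclic_ring l). \<forall>p\<in>a. \<forall>q\<in>b. \<forall>g.
        g = gcd p (gcd q (x_pow_minus_one l)) \<longrightarrow>
          g dvd x_pow_minus_one l
          \<and> (\<exists>u\<in>carrier (cyclic_ring l). \<exists>v\<in>carrier (cyclic_ring l).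
               a = residue_class l g \<otimes>\<^bsub>cyclic_ring l\<^esub> u \<and> b = residue_class l g \<otimes>\<^bsub>cyclic_ring l\<^esub> v)
          \<and> real (degree g) = real_of_int (bicycle_dim l a b) / 2)"
proof (intro conjI allI impI ballI; (elim conjE)?)
  note l = \<open>l > 0\<close>
  let ?M = "x_pow_minus_one l"
  have M0: "?M \<noteq> 0"
    using l degree_x_pow_minus_one[of l] by auto
  {
    fix g u v a b
    assume g: "g dvd ?M" and u: "u \<in> carrier (cyclic_ring l)" and v: "v \<in> carrier (cyclic_ring l)"
      and a: "a = residue_class l g \<otimes>\<^bsub>cyclic_ring l\<^esub> u"
      and b: "b = residue_class l g \<otimes>\<^bsub>cyclic_ring l\<^esub> v"
    \<comment> \<open>An exact value from which both bounds follow: the second summand is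
      nonnegative, and the upper bound is an equality.\<close>
    have dim: "bicycle_dim l a b = 2 * int (degree g) + 2 * int (degree (gcd p (gcd q (?M div g))))"
      if "p \<in> u" "q \<in> v" for p q
      using residue_class_eq_of_mem[OF u that(1)] residue_class_eq_of_mem[OF v that(2)]
      by (simp add: a b residue_class_mult bicycle_dim_eq[OF l] degree_gcd_mult_dvd[OF g M0])
    \<comment> \<open>The lower bound mentions no representatives, so some must be chosen; cosets
      are nonempty.\<close>
    obtain p q where "p \<in> u" "q \<in> v"
      using u v by (auto simp: carrier_cyclic_ring mem_residue_class_iff) (metis diff_self dvd_0_right)
    then show "2 * int (degree g) \<le> bicycle_dim l a b"
      by (simp add: dim)
    fix p q assume pq: "p \<in> u" "q \<in> v"
    show "bicycle_dim l a b \<le> 2 * int (degree g) + 2 * int (degree (gcd p (gcd q (?M div g))))"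
      using dim[OF pq] by simp
    assume irr: "\<not> (\<exists>f. irreducible f \<and> f dvd ?M div g \<and> f dvd p \<and> f dvd q)"
    let ?h = "gcd p (gcd q (?M div g))"
    have "?M div g \<noteq> 0"
      using g M0 by (auto elim!: dvdE)
    then have "?h \<noteq> 0"
      by simp
    \<comment> \<open>A prime divisor of a nonunit gcd would be a forbidden common irreducible
      factor.\<close>
    have "is_unit ?h"
    proof (rule ccontr)
      assume "\<not> is_unit ?h"
      with \<open>?h \<noteq> 0\<close> obtain f where "f dvd ?h" "prime f"
        using prime_divisor_exists by blast
      then show False
        using irr by (metis dvd_trans gcd_dvd1 gcd_dvd2 prime_elem_imp_irreducible prime_imp_prime_elem)
    qed
    then have "degree ?h = 0"
      by (simp add: is_unit_iff_degree \<open>?h \<noteq> 0\<close>)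
    then show "bicycle_dim l a b = 2 * int (degree g)"
      using dim[OF pq] by simp
  }
  fix a b p q g
  assume a: "a \<in> carrier (cyclic_ring l)" and b: "b \<in> carrier (cyclic_ring l)"
    and p: "p \<in> a" and q: "q \<in> b" and g: "g = gcd p (gcd q ?M)"
  note a_eq = residue_class_eq_of_mem[OF a p] and b_eq = residue_class_eq_of_mem[OF b q]
  show "g dvd ?M"
    unfolding g by (metis dvd_trans gcd_dvd2)
  \<comment> \<open>The classes of the cofactors of \<open>g\<close> in \<open>p\<close> and
    \<open>q\<close> serve as u and v.\<close>
  obtain p' where p': "p = g * p'"
    unfolding g using gcd_dvd1 by (metis dvdE)
  obtain q' where q': "q = g * q'"
    unfolding g using gcd_dvd1 gcd_dvd2 by (metis dvd_trans dvdE)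
  have "a = residue_class l g \<otimes>\<^bsub>cyclic_ring l\<^esub> residue_class l p'"
    "b = residue_class l g \<otimes>\<^bsub>cyclic_ring l\<^esub> residue_class l q'"
    using a_eq b_eq p' q' by (simp_all add: residue_class_mult)
  then show "\<exists>u\<in>carrier (cyclic_ring l). \<exists>v\<in>carrier (cyclic_ring l).
      a = residue_class l g \<otimes>\<^bsub>cyclic_ring l\<^esub> u \<and> b = residue_class l g \<otimes>\<^bsub>cyclic_ring l\<^esub> v"
    unfolding carrier_cyclic_ring by blast
  show "real (degree g) = real_of_int (bicycle_dim l a b) / 2"
    by (simp add: a_eq b_eq bicycle_dim_eq[OF l] g)
qed

end
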